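(* Let $\mathcal{P}(\mathbb{N})$ be Scott's graph model and $C(A)=\mathbb{N}-A$ the complement function on it. The Cantor topology on $\mathcal{P}(\mathbb{N})$ is a conrep topology for the pca $\mathcal{P}(\mathbb{N})[C]$.
   Context: A partial combinatory algebra (pca) is a set $\mathcal{A}$ with a partial binary application $(a,b)\mapsto ab$ (associating to the left) such that there are $\mathsf{k},\mathsf{s}\in\mathcal{A}$ with, for all $a,b,c$: $\mathsf{k}ab=a$; $\mathsf{s}ab$ is defined; and whenever $(ac)(bc)$ is defined, $\mathsf{s}abc$ is defined and equals $(ac)(bc)$. A partial function $f:\mathcal{A}\to\mathcal{A}$ is representable in $\mathcal{A}$ if there is $a_f\in\mathcal{A}$ with $a_fa=f(a)$ for all $a$ in the domain of $f$. A topology on a pca $\mathcal{A}$ is conrep if every partial function $\mathcal{A}\to\mathcal{A}$ that is continuous on its domain (as subspace) is representable in $\mathcal{A}$. Every pca contains booleans $\mathsf{T},\mathsf{F}$ with a definition-by-cases element $D$ ($D\mathsf{T}ab=a$, $D\mathsf{F}ab=b$), and standard codings $[a,b]$ of pairs and $[a_0,\ldots,a_{n-1}]$ of finite sequences whose basic operations (length, projections, appending) are representable; fix such choices. For a pca $\mathcal{A}$ and a partial function $f:\mathcal{A}\to\mathcal{A}$, $\mathcal{A}[f]$ is the pca with underlying set $\mathcal{A}$ and application $\cdot_f$ defined by: $a\cdot_f b=c$ iff there is a finite sequence $e_0,\ldots,e_{n-1}$ in $\mathcal{A}$ (on each of which $f$ is defined) such that $a[b,f(e_0),\ldots,f(e_{i-1})]=[\mathsf{F},e_i]$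 for all $i<n$ and $a[b,f(e_0),\ldots,f(e_{n-1})]=[\mathsf{T},c]$. (It is known that this is a pca, that $f$ is representable in it, and that application of $\mathcal{A}$ is representable in it.) Scott's graph model is the set $\mathcal{P}(\mathbb{N})$ with application $A\circ B=\{n\mid \exists m\,([m,n]\in A,\ e_m\subseteq B)\}$, where $[\cdot,\cdot]$ is a standard bijective pairing on $\mathbb{N}$ and $e_k$ is the finite set $p$ with $k=\sum_{i\in p}2^i$. The Cantor topology on $\mathcal{P}(\mathbb{N})$ has as basis the sets $U_p^q=\{A\subseteq\mathbb{N}\mid p\subseteq A,\ A\cap q=\emptyset\}$ for disjoint finite $p,q\subseteq\mathbb{N}$. *)

theory Defs
  imports "HOL-Analysis.Analysis" "HOL-Library.Nat_Bijection"
begin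

section \<open>Partial combinatory algebras\<close>

text \<open>A partial binary operation is a function \<^term>\<open>app :: 'a \<Rightarrow> 'a \<Rightarrow> 'a option\<close>, the underlying
  set being the whole type. \<open>lift_app\<close> extends it strictly to possibly undefined terms: a
  compound term denotes iff all its subterms do.\<close>

context
  fixes app :: "'a \<Rightarrow> 'a \<Rightarrow> 'a option"
begin

definition lift_app :: "'a option \<Rightarrow> 'a option \<Rightarrow> 'a option"  (infixl "\<cdot>" 70)
  where "x \<cdot> y = Option.bind x (\<lambda>a. Option.bind y (\<lambda>b. app a b))"

definition pca :: bool
  where "pca \<longleftrightarrow> (\<exists>k s. \<forall>a b c.
      Some k \<cdot> Some a \<cdot> Some b = Some a \<and>
      Some s \<cdot> Some a \<cdot> Some b \<noteq> None \<and>
      ((Some a \<cdot> Some c) \<cdot> (Some b \<cdot> Some c) \<noteq> None \<longrightarrow>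
        Some s \<cdot> Some a \<cdot> Some b \<cdot> Some c = (Some a \<cdot> Some c) \<cdot> (Some b \<cdot> Some c)))"

definition representable :: "('a \<rightharpoonup> 'a) \<Rightarrow> bool"
  where "representable f \<longleftrightarrow> (\<exists>r. \<forall>a\<in>dom f. app r a = f a)"

definition conrep_topology :: "'a topology \<Rightarrow> bool"
  where "conrep_topology X \<longleftrightarrow> pca \<and> topspace X = UNIV \<and>
    (\<forall>f. continuous_map (subtopology X (dom f)) X (\<lambda>a. the (f a)) \<longrightarrow> representable f)"

end


section \<open>Codings and the adjunction of a partial function\<close>

text \<open>A choice of booleans, pairs and codes of finite sequences. Since lengths and indices of
  sequences have to be elements of the algebra, the choice includes numerals.\<close>

record 'a coding =
  ctrue :: 'a
  cfalse :: 'a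
  cpair :: "'a \<Rightarrow> 'a \<Rightarrow> 'a"
  cnum :: "nat \<Rightarrow> 'a"
  cseq :: "'a list \<Rightarrow> 'a"

context
  fixes app :: "'a \<Rightarrow> 'a \<Rightarrow> 'a option" and C :: "'a coding"
begin

private abbreviation (input) lift_app' (infixl "\<cdot>" 70)
  where "x \<cdot> y \<equiv> lift_app app x y"

definition standard_coding :: bool
  where "standard_coding \<longleftrightarrow>
    (\<exists>d. \<forall>a b. Some d \<cdot> Some (ctrue C) \<cdot> Some a \<cdot> Some b = Some a \<and>
      Some d \<cdot> Some (cfalse C) \<cdot> Some a \<cdot> Some b = Some b) \<and>
    (\<exists>p p0 p1. \<forall>a b. Some p \<cdot> Some a \<cdot> Some b = Some (cpair C a b) \<and>
      Some p0 \<cdot> Some (cpair C a b) = Some a \<and> Some p1 \<cdot> Some (cpair C a b) = Some b) \<and>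
    (\<exists>zero succ pred. Some zero \<cdot> Some (cnum C 0) = Some (ctrue C) \<and>
      (\<forall>n. Some zero \<cdot> Some (cnum C (Suc n)) = Some (cfalse C) \<and>
        Some succ \<cdot> Some (cnum C n) = Some (cnum C (Suc n)) \<and>
        Some pred \<cdot> Some (cnum C (Suc n)) = Some (cnum C n))) \<and>
    (\<exists>len. \<forall>xs. Some len \<cdot> Some (cseq C xs) = Some (cnum C (length xs))) \<and>
    (\<exists>proj. \<forall>xs. \<forall>i<length xs. Some proj \<cdot> Some (cnum C i) \<cdot> Some (cseq C xs) = Some (xs ! i)) \<and>
    (\<exists>snoc. \<forall>xs a. Some snoc \<cdot> Some (cseq C xs) \<cdot> Some a = Some (cseq C (xs @ [a])))"

text \<open>The list \<open>es\<close> consists of the queries put to \<open>f\<close> in the computation of \<open>a\<close> on input \<open>b\<close>.\<close>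

definition oracle_computes :: "('a \<rightharpoonup> 'a) \<Rightarrow> 'a \<Rightarrow> 'a \<Rightarrow> 'a \<Rightarrow> bool"
  where "oracle_computes f a b c \<longleftrightarrow> (\<exists>es. set es \<subseteq> dom f \<and>
    (\<forall>i<length es. app a (cseq C (b # map (\<lambda>e. the (f e)) (take i es)))
        = Some (cpair C (cfalse C) (es ! i))) \<and>
    app a (cseq C (b # map (\<lambda>e. the (f e)) es)) = Some (cpair C (ctrue C) c))"

text \<open>For a \<open>standard_coding\<close> there is at most one such \<open>c\<close>.\<close>

definition adjoin :: "('a \<rightharpoonup> 'a) \<Rightarrow> 'a \<Rightarrow> 'a \<Rightarrow> 'a option"
  where "adjoin f a b =
    (if \<exists>c. oracle_computes f a b c then Some (THE c. oracle_computes f a b c) else None)"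

end


section \<open>Scott's graph model and the Cantor topology\<close>

text \<open>\<^term>\<open>set_decode m\<close> is the finite set \<open>p\<close> with \<open>m = (\<Sum>i\<in>p. 2 ^ i)\<close>.\<close>

definition graph_app :: "nat set \<Rightarrow> nat set \<Rightarrow> nat set option"
  where "graph_app A B = Some {n. \<exists>m. prod_encode (m, n) \<in> A \<and> set_decode m \<subseteq> B}"

definition cantor_basic :: "nat set \<Rightarrow> nat set \<Rightarrow> nat set set"
  where "cantor_basic p q = {A. p \<subseteq> A \<and> A \<inter> q = {}}"

definition cantor_topology :: "nat set topology"
  where "cantor_topology =
    topology_generated_by {cantor_basic p q | p q. finite p \<and> finite q \<and> p \<inter> q = {}}"

lemma openin_cantor_basic:
  assumes "finite p" "finite q" "p \<inter> q = {}"
  shows "openin cantor_topology (cantor_basic p q)"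
  unfolding cantor_topology_def
  by (rule topology_generated_by_Basis, rule CollectI, intro exI conjI, rule refl) (rule assms)+

lemma topspace_cantor_topology: "topspace cantor_topology = UNIV"
proof -
  have "cantor_basic {} {} = UNIV" by (simp add: cantor_basic_def)
  then show ?thesis
    using openin_subset[OF openin_cantor_basic[of "{}" "{}"]] by (simp add: top.extremum_unique)
qed

lemma openin_cantor_topology_iff: "openin cantor_topology U \<longleftrightarrow>
    (\<forall>A\<in>U. \<exists>p q. finite p \<and> finite q \<and> p \<inter> q = {} \<and> A \<in> cantor_basic p q \<and> cantor_basic p q \<subseteq> U)"
  (is "_ \<longleftrightarrow> (\<forall>A\<in>U. ?N A U)")
proof
  assume "openin cantor_topology U"
  then have "generate_topology_on {cantor_basic p q | p q. finite p \<and> finite q \<and> p \<inter> q = {}} U"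
    unfolding cantor_topology_def by (rule openin_topology_generated_by)
  then show "\<forall>A\<in>U. ?N A U"
  proof (induction rule: generate_topology_on.induct)
    case Empty
    show ?case by (rule ballI) (erule emptyE)
  next
    case (Int U V)
    show ?case
    proof
      fix A assume A: "A \<in> U \<inter> V"
      from bspec[OF Int.IH(1) IntD1[OF A]] obtain p q where
        U: "finite p" "finite q" "A \<in> cantor_basic p q" "cantor_basic p q \<subseteq> U" by (elim exE conjE)
      from bspec[OF Int.IH(2) IntD2[OF A]] obtain p' q' where
        V: "finite p'" "finite q'" "A \<in> cantor_basic p' q'" "cantor_basic p' q' \<subseteq> V" by (elim exE conjE)
      have eq: "cantor_basic (p \<union> p') (q \<union> q') = cantor_basic p q \<inter> cantor_basic p' q'"
        by (auto simp: cantor_basic_def)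
      have "A \<in> cantor_basic (p \<union> p') (q \<union> q')"
        using U(3) V(3) eq by simp
      moreover from this have "(p \<union> p') \<inter> (q \<union> q') = {}"
        by (auto simp: cantor_basic_def)
      moreover have "cantor_basic (p \<union> p') (q \<union> q') \<subseteq> U \<inter> V"
        using U(4) V(4) eq by blast
      ultimately show "?N A (U \<inter> V)"
        using U(1,2) V(1,2) by (intro exI[of _ "p \<union> p'"] exI[of _ "q \<union> q'"]) simp
    qed
  next
    case (UN K)
    show ?case
    proof
      fix A assume "A \<in> \<Union>K"
      then obtain k where k: "k \<in> K" "A \<in> k" by (elim UnionE)
      from bspec[OF UN.IH[OF k(1)] k(2)] obtain p q where
        "finite p" "finite q" "p \<inter> q = {}" "A \<in> cantor_basic p q" "cantor_basic p q \<subseteq> k"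
        by (elim exE conjE)
      with k(1) show "?N A (\<Union>K)"
        by (intro exI[of _ p] exI[of _ q] conjI) (assumption | rule subset_trans[OF _ Union_upper])+
    qed
  next
    case (Basis V)
    then obtain p q where "finite p" "finite q" "p \<inter> q = {}" "V = cantor_basic p q" by blast
    then show ?case by (intro ballI exI[of _ p] exI[of _ q]) simp
  qed
next
  assume N: "\<forall>A\<in>U. ?N A U"
  have "\<exists>V. openin cantor_topology V \<and> A \<in> V \<and> V \<subseteq> U" if "A \<in> U" for A
    using N[rule_format, OF that] openin_cantor_basic by (elim exE conjE) (intro exI conjI)
  then show "openin cantor_topology U"
    by (intro openin_subopen[THEN iffD2] ballI)
qed

end

theory Submission
  imports Defs
begin

text \<open>Over the graph model every Scott-continuous function is represented by an element of the
  algebra, so an oracle program may be given as any function, continuous in all its arguments, from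
  the input and the list of answers received so far to the next query or the final output. Such
  programs can be run one after the other, which yields the combinators of \<open>\<P>(\<nat>)[C]\<close>. For
  representability, a program learns \<open>\<nat> - B\<close> from its input \<open>B\<close> by a single query, and a
  Cantor-continuous partial function of \<open>B\<close> is the restriction of a Scott-continuous function of
  \<open>B\<close> and \<open>\<nat> - B\<close>.\<close>

section \<open>Scott continuity\<close>

text \<open>One equivalence packs both halves of Scott openness: right to left, it is upward closed;
  left to right, finitely many elements of \<open>X\<close> already witness it.\<close>

definition scott_open :: "(nat set \<Rightarrow> bool) \<Rightarrow> bool"
  where "scott_open P \<longleftrightarrow> (\<forall>X. P X \<longleftrightarrow> (\<exists>p. finite p \<and> p \<subseteq> X \<and> P p))"

text \<open>The sets of all \<open>A\<close> containing a given \<open>y\<close> form a subbasis of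
  the Scott topology, so continuity may be tested on them.\<close>

definition scott :: "(nat set \<Rightarrow> nat set) \<Rightarrow> bool"
  where "scott F \<longleftrightarrow> (\<forall>y. scott_open (\<lambda>X. y \<in> F X))"

text \<open>Continuous families of lists have constant length.\<close>

definition scott_list :: "(nat set \<Rightarrow> nat set list) \<Rightarrow> bool"
  where "scott_list L \<longleftrightarrow> (\<exists>Fs. (\<forall>F\<in>set Fs. scott F) \<and> L = (\<lambda>X. map (\<lambda>F. F X) Fs))"

lemma scott_open_mono: "scott_open P \<Longrightarrow> P X \<Longrightarrow> X \<subseteq> Y \<Longrightarrow> P Y"
  unfolding scott_open_def by (meson subset_trans)

lemma scott_openE:
  assumes "scott_open P" "P X"
  obtains p where "finite p" "p \<subseteq> X" "P p"
  using assms unfolding scott_open_def by blast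

lemma scott_openI:
  assumes "\<And>X Y. P X \<Longrightarrow> X \<subseteq> Y \<Longrightarrow> P Y" "\<And>X. P X \<Longrightarrow> \<exists>p. finite p \<and> p \<subseteq> X \<and> P p"
  shows "scott_open P"
  unfolding scott_open_def using assms by blast

lemma scott_open_const: "scott_open (\<lambda>X. c)"
  unfolding scott_open_def by blast

lemma scott_open_conj:
  assumes "scott_open P" "scott_open Q"
  shows "scott_open (\<lambda>X. P X \<and> Q X)"
proof (rule scott_openI)
  fix X assume "P X \<and> Q X"
  then obtain p q where "finite p" "p \<subseteq> X" "P p" "finite q" "q \<subseteq> X" "Q q"
    using assms by (meson scott_openE)
  then have "finite (p \<union> q) \<and> p \<union> q \<subseteq> X \<and> P (p \<union> q) \<and> Q (p \<union> q)"
    using scott_open_mono[OF assms(1), of p "p \<union> q"] scott_open_mono[OF assms(2), of q "p \<union> q"]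
    by simp
  then show "\<exists>p. finite p \<and> p \<subseteq> X \<and> P p \<and> Q p" by blast
qed (use assms scott_open_mono in blast)

lemma scott_open_ex: "(\<And>i. scott_open (P i)) \<Longrightarrow> scott_open (\<lambda>X. \<exists>i. P i X)"
  by (rule scott_openI) (meson scott_open_mono, meson scott_openE)

lemma scott_open_disj: "scott_open P \<Longrightarrow> scott_open Q \<Longrightarrow> scott_open (\<lambda>X. P X \<or> Q X)"
  by (rule scott_openI) (meson scott_open_mono, meson scott_openE)

lemma scott_open_Ball:
  assumes "finite S" "\<And>i. i \<in> S \<Longrightarrow> scott_open (P i)"
  shows "scott_open (\<lambda>X. \<forall>i\<in>S. P i X)"
  using assms by (induction S) (simp_all add: scott_open_const scott_open_conj)

lemma scott_open_less: "(\<And>i. scott_open (P i)) \<Longrightarrow> scott_open (\<lambda>X. \<forall>i<n::nat. P i X)"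
  using scott_open_Ball[of "{..<n}" P] by (simp add: lessThan_def)

lemma scott_open_le: "(\<And>i. scott_open (P i)) \<Longrightarrow> scott_open (\<lambda>X. \<forall>i\<le>n::nat. P i X)"
  using scott_open_Ball[of "{..n}" P] by (simp add: atMost_def)

lemma scott_open_mem: "scott F \<Longrightarrow> scott_open (\<lambda>X. y \<in> F X)"
  unfolding scott_def by blast

lemma scott_open_subset:
  assumes "finite q" "scott F"
  shows "scott_open (\<lambda>X. q \<subseteq> F X)"
  using scott_open_Ball[OF assms(1), of "\<lambda>i X. i \<in> F X"] scott_open_mem[OF assms(2)]
  by (simp add: subset_iff Ball_def)

lemmas scott_open_intros = scott_open_conj scott_open_disj scott_open_ex scott_open_less
  scott_open_le scott_open_mem scott_open_subset

lemma scottI: "(\<And>y. scott_open (\<lambda>X. y \<in> F X)) \<Longrightarrow> scott F"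
  unfolding scott_def by blast

lemma scott_mono: "scott F \<Longrightarrow> X \<subseteq> Y \<Longrightarrow> F X \<subseteq> F Y"
  using scott_open_mono[OF scott_open_mem] by blast

lemma scott_const: "scott (\<lambda>X. A)"
  by (simp add: scott_def scott_open_const)

lemma scott_id: "scott (\<lambda>X. X)"
proof (intro scottI scott_openI)
  fix y :: nat and X assume "y \<in> X"
  then show "\<exists>p. finite p \<and> p \<subseteq> X \<and> y \<in> p" by (intro exI[of _ "{y}"]) simp
qed blast

lemma scott_list_const: "scott_list (\<lambda>X. xs)"
  unfolding scott_list_def
  by (rule exI[of _ "map (\<lambda>A X. A) xs"]) (auto simp: comp_def scott_const)

lemma scott_list_Cons:
  assumes "scott F" "scott_list L"
  shows "scott_list (\<lambda>X. F X # L X)"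
proof -
  obtain Fs where "\<forall>F\<in>set Fs. scott F" "L = (\<lambda>X. map (\<lambda>F. F X) Fs)"
    using assms(2) unfolding scott_list_def by blast
  then show ?thesis
    unfolding scott_list_def using assms(1) by (intro exI[of _ "F # Fs"]) simp
qed

lemma scott_list_take:
  assumes "scott_list L"
  shows "scott_list (\<lambda>X. take i (L X))"
proof -
  obtain Fs where "\<forall>F\<in>set Fs. scott F" "L = (\<lambda>X. map (\<lambda>F. F X) Fs)"
    using assms unfolding scott_list_def by blast
  then show ?thesis
    unfolding scott_list_def
    by (intro exI[of _ "take i Fs"]) (auto simp: take_map dest: in_set_takeD)
qed

lemma scott_list_drop:
  assumes "scott_list L"
  shows "scott_list (\<lambda>X. drop i (L X))"
proof -
  obtain Fs where "\<forall>F\<in>set Fs. scott F" "L = (\<lambda>X. map (\<lambda>F. F X) Fs)"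
    using assms unfolding scott_list_def by blast
  then show ?thesis
    unfolding scott_list_def
    by (intro exI[of _ "drop i Fs"]) (auto simp: drop_map dest: in_set_dropD)
qed

lemma scott_list_map:
  assumes "\<And>i. scott (F i)"
  shows "scott_list (\<lambda>X. map (\<lambda>i. F i X) is)"
  unfolding scott_list_def by (rule exI[of _ "map F is"]) (auto simp: assms comp_def)

section \<open>The graph model\<close>

definition gapp :: "nat set \<Rightarrow> nat set \<Rightarrow> nat set"  (infixl "\<bullet>\<bullet>" 75)
  where "A \<bullet>\<bullet> B = {n. \<exists>m. prod_encode (m, n) \<in> A \<and> set_decode m \<subseteq> B}"

text \<open>This is the graph of \<open>F\<close>: the codes of pairs \<open>(m, n)\<close> such
  that \<open>n\<close> is in the value of \<open>F\<close> at the finite set coded by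
  \<open>m\<close>.\<close>

definition lam :: "(nat set \<Rightarrow> nat set) \<Rightarrow> nat set"
  where "lam F = {k. snd (prod_decode k) \<in> F (set_decode (fst (prod_decode k)))}"

lemma lift_app_Some: "lift_app f (Some a) (Some b) = f a b"
  by (simp add: lift_app_def)

lemma graph_app_eq: "graph_app A B = Some (A \<bullet>\<bullet> B)"
  by (simp add: graph_app_def gapp_def)

lemma scott_gapp:
  assumes "scott F" "scott G"
  shows "scott (\<lambda>X. F X \<bullet>\<bullet> G X)"
  unfolding gapp_def
  by (rule scottI, unfold mem_Collect_eq)
    (intro scott_open_intros assms finite_set_decode)

text \<open>Monotonicity of \<open>F\<close> gives one inclusion; the finite witness for membership
  in \<open>F X\<close> gives the other.\<close>

lemma lam_gapp:
  assumes "scott F"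
  shows "lam F \<bullet>\<bullet> X = F X"
proof (intro set_eqI iffI)
  fix n assume "n \<in> lam F \<bullet>\<bullet> X"
  then obtain m where "n \<in> F (set_decode m)" "set_decode m \<subseteq> X"
    by (auto simp: lam_def gapp_def)
  then show "n \<in> F X"
    using scott_mono[OF assms] by blast
next
  fix n assume "n \<in> F X"
  with scott_open_mem[OF assms] obtain p where "finite p" "p \<subseteq> X" "n \<in> F p"
    by (rule scott_openE)
  then show "n \<in> lam F \<bullet>\<bullet> X"
    unfolding lam_def gapp_def mem_Collect_eq by (intro exI[of _ "set_encode p"]) simp
qed

text \<open>Whether \<open>k\<close> lies in \<open>lam (F X)\<close> depends on \<open>F X\<close>
  at a single finite set, so continuity in \<open>X\<close> for each fixed \<open>Y\<close>
  suffices.\<close>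

lemma scott_lam:
  assumes "\<And>Y. scott (\<lambda>X. F X Y)"
  shows "scott (\<lambda>X. lam (F X))"
  unfolding lam_def by (rule scottI, unfold mem_Collect_eq) (rule scott_open_mem[OF assms])

section \<open>Oracle programs\<close>

text \<open>Application of the graph model is total, so the requirements on a coding become plain
  equations between sets.\<close>

locale graph_coding =
  fixes C :: "nat set coding"
    and d p p0 p1 zero pred len proj snoc :: "nat set"
  assumes d_true: "d \<bullet>\<bullet> ctrue C \<bullet>\<bullet> A \<bullet>\<bullet> B = A"
    and d_false: "d \<bullet>\<bullet> cfalse C \<bullet>\<bullet> A \<bullet>\<bullet> B = B"
    and pair: "p \<bullet>\<bullet> A \<bullet>\<bullet> B = cpair C A B"
    and p0: "p0 \<bullet>\<bullet> cpair C A B = A"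
    and p1: "p1 \<bullet>\<bullet> cpair C A B = B"
    and zero_0: "zero \<bullet>\<bullet> cnum C 0 = ctrue C"
    and zero_Suc: "zero \<bullet>\<bullet> cnum C (Suc n) = cfalse C"
    and pred: "pred \<bullet>\<bullet> cnum C (Suc n) = cnum C n"
    and len: "len \<bullet>\<bullet> cseq C xs = cnum C (length xs)"
    and proj: "i < length xs \<Longrightarrow> proj \<bullet>\<bullet> cnum C i \<bullet>\<bullet> cseq C xs = xs ! i"
    and snoc: "snoc \<bullet>\<bullet> cseq C xs \<bullet>\<bullet> A = cseq C (xs @ [A])"
begin

section \<open>Separating the booleans\<close>

lemma gapp_mono: "A \<subseteq> A' \<Longrightarrow> A \<bullet>\<bullet> B \<subseteq> A' \<bullet>\<bullet> B"
  by (rule scott_mono[OF scott_gapp[OF scott_id scott_const]])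

lemma gapp_mono': "B \<subseteq> B' \<Longrightarrow> A \<bullet>\<bullet> B \<subseteq> A \<bullet>\<bullet> B'"
  by (rule scott_mono[OF scott_gapp[OF scott_const scott_id]])

text \<open>Comparable booleans would make definition by cases monotone in the boolean, so that
  all elements would be comparable.\<close>

lemma not_true_le_false: "\<not> ctrue C \<subseteq> cfalse C"
proof
  assume "ctrue C \<subseteq> cfalse C"
  then have "d \<bullet>\<bullet> ctrue C \<bullet>\<bullet> UNIV \<bullet>\<bullet> {} \<subseteq> d \<bullet>\<bullet> cfalse C \<bullet>\<bullet> UNIV \<bullet>\<bullet> {}"
    by (intro gapp_mono gapp_mono')
  then show False unfolding d_true d_false by simp
qed

lemma not_false_le_true: "\<not> cfalse C \<subseteq> ctrue C"
proof
  assume "cfalse C \<subseteq> ctrue C"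
  then have "d \<bullet>\<bullet> cfalse C \<bullet>\<bullet> {} \<bullet>\<bullet> UNIV \<subseteq> d \<bullet>\<bullet> ctrue C \<bullet>\<bullet> {} \<bullet>\<bullet> UNIV"
    by (intro gapp_mono gapp_mono')
  then show False unfolding d_true d_false by simp
qed

text \<open>Equality with a boolean is not Scott open. Membership of a number that separates the two
  booleans is, and it decides between them.\<close>

definition t_mark :: nat where "t_mark = (SOME n. n \<in> ctrue C - cfalse C)"
definition f_mark :: nat where "f_mark = (SOME n. n \<in> cfalse C - ctrue C)"

lemma t_mark: "t_mark \<in> ctrue C" "t_mark \<notin> cfalse C"
proof -
  have "t_mark \<in> ctrue C - cfalse C"
    unfolding t_mark_def by (rule someI_ex) (use not_true_le_false in blast)
  then show "t_mark \<in> ctrue C" "t_mark \<notin> cfalse C" by auto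
qed

lemma f_mark: "f_mark \<in> cfalse C" "f_mark \<notin> ctrue C"
proof -
  have "f_mark \<in> cfalse C - ctrue C"
    unfolding f_mark_def by (rule someI_ex) (use not_false_le_true in blast)
  then show "f_mark \<in> cfalse C" "f_mark \<notin> ctrue C" by auto
qed

lemma scott_cpair: "scott F \<Longrightarrow> scott G \<Longrightarrow> scott (\<lambda>X. cpair C (F X) (G X))"
  unfolding pair[symmetric] by (intro scott_gapp scott_const)

text \<open>Codes grow by \<open>snoc\<close>, hence the induction from the right. It yields
  continuity because the length of the list does not vary with \<open>X\<close>.\<close>

lemma scott_cseq:
  assumes "scott_list L"
  shows "scott (\<lambda>X. cseq C (L X))"
proof -
  have "scott (\<lambda>X. cseq C (map (\<lambda>F. F X) Fs))" if "\<forall>F\<in>set Fs. scott F" for Fs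
    using that
    by (induction Fs rule: rev_induct) (auto simp: snoc[symmetric] intro!: scott_const scott_gapp)
  then show ?thesis
    using assms unfolding scott_list_def by blast
qed

text \<open>The predecessor is iterated on the length until the zero test succeeds. Only positive
  membership of marks is asked, which keeps the condition Scott open on all sets, codes or
  not.\<close>

definition has_length :: "nat \<Rightarrow> nat set \<Rightarrow> bool"
  where "has_length n X \<longleftrightarrow>
    (\<forall>i<n. f_mark \<in> zero \<bullet>\<bullet> (((\<bullet>\<bullet>) pred ^^ i) (len \<bullet>\<bullet> X))) \<and>
    t_mark \<in> zero \<bullet>\<bullet> (((\<bullet>\<bullet>) pred ^^ n) (len \<bullet>\<bullet> X))"

lemma pred_funpow: "i \<le> n \<Longrightarrow> ((\<bullet>\<bullet>) pred ^^ i) (cnum C n) = cnum C (n - i)"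
proof (induction i)
  case (Suc i)
  then have "((\<bullet>\<bullet>) pred ^^ Suc i) (cnum C n) = pred \<bullet>\<bullet> cnum C (Suc (n - Suc i))"
    by (simp add: Suc_diff_Suc)
  then show ?case by (simp only: pred)
qed simp

lemma zero_pred_funpow:
  "i < n \<Longrightarrow> zero \<bullet>\<bullet> (((\<bullet>\<bullet>) pred ^^ i) (cnum C n)) = cfalse C"
  "zero \<bullet>\<bullet> (((\<bullet>\<bullet>) pred ^^ n) (cnum C n)) = ctrue C"
  using zero_Suc[of "n - Suc i"] by (simp_all add: pred_funpow zero_0 Suc_diff_Suc)

text \<open>If \<open>n\<close> is too small, the zero test at \<open>n\<close> gives false, which
  lacks \<open>t_mark\<close>; if \<open>n\<close> is too large, the test at
  \<open>length xs\<close> gives true, which lacks \<open>f_mark\<close>.\<close>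

lemma has_length_cseq: "has_length n (cseq C xs) \<longleftrightarrow> n = length xs"
proof
  assume n: "has_length n (cseq C xs)"
  have "\<not> n < length xs"
    using n t_mark by (auto simp: has_length_def len zero_pred_funpow)
  moreover have "\<not> length xs < n"
    using n f_mark by (auto simp: has_length_def len zero_pred_funpow)
  ultimately show "n = length xs" by simp
qed (auto simp: has_length_def len zero_pred_funpow t_mark f_mark)

lemma scott_open_has_length: "scott_open (has_length n)"
proof -
  have "scott (\<lambda>X. ((\<bullet>\<bullet>) pred ^^ i) (len \<bullet>\<bullet> X))" for i
    by (induction i) (simp_all add: scott_gapp scott_const scott_id)
  then show ?thesis
    unfolding has_length_def by (intro scott_open_intros scott_gapp scott_const)
qed

text \<open>A program is given by the next step as a function of the input and the answers so far.\<close>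

definition prog :: "(nat set \<Rightarrow> nat set list \<Rightarrow> nat set) \<Rightarrow> nat set"
  where "prog P = lam (\<lambda>X. {y. \<exists>n. has_length (Suc n) X \<and>
    y \<in> P (proj \<bullet>\<bullet> cnum C 0 \<bullet>\<bullet> X) (map (\<lambda>i. proj \<bullet>\<bullet> cnum C i \<bullet>\<bullet> X) [1..<Suc n])})"

lemma prog_cseq:
  assumes "\<And>F L. scott F \<Longrightarrow> scott_list L \<Longrightarrow> scott (\<lambda>X. P (F X) (L X))"
  shows "prog P \<bullet>\<bullet> cseq C (b # ys) = P b ys"
proof -
  \<comment> \<open>Entry 0 of the coded sequence is the input, so \<open>n\<close> answers occupy
    the positions 1 to \<open>n\<close> and the total length is \<open>Suc n\<close>.\<close>
  have "map (\<lambda>i. proj \<bullet>\<bullet> cnum C i \<bullet>\<bullet> cseq C (b # ys)) [1..<Suc (length ys)] = ys"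
    by (rule nth_equalityI) (simp_all add: proj del: upt_Suc)
  \<comment> \<open>For each fixed \<open>n\<close> the list of answers has constant length, as
    continuity of lists requires; the union over \<open>n\<close> is then harmless.\<close>
  moreover have "scott (\<lambda>X. {y. \<exists>n. has_length (Suc n) X \<and>
      y \<in> P (proj \<bullet>\<bullet> cnum C 0 \<bullet>\<bullet> X) (map (\<lambda>i. proj \<bullet>\<bullet> cnum C i \<bullet>\<bullet> X) [1..<Suc n])})"
    by (rule scottI, unfold mem_Collect_eq)
      (intro scott_open_intros scott_open_has_length assms scott_list_map scott_gapp scott_const
        scott_id)
  ultimately show ?thesis
    unfolding prog_def by (subst lam_gapp) (simp_all add: has_length_cseq proj del: upt_Suc)
qed

text \<open>This lets programs depend on parameters, so that one program can return another, as
  currying of the combinators requires.\<close>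

lemma scott_prog:
  assumes "\<And>b ys. scott (\<lambda>X. P X b ys)"
  shows "scott (\<lambda>X. prog (P X))"
  unfolding prog_def
  by (rule scott_lam, rule scottI, unfold mem_Collect_eq)
    (intro scott_open_conj scott_open_ex scott_open_const scott_open_mem assms)

section \<open>Building blocks of programs\<close>

definition run :: "nat set \<Rightarrow> nat set \<Rightarrow> nat set list \<Rightarrow> nat set"
  where "run a b ys = a \<bullet>\<bullet> cseq C (b # ys)"

definition ret :: "nat set \<Rightarrow> nat set list \<Rightarrow> nat set"
  where "ret c ys = cpair C (ctrue C) c"

definition query :: "nat set \<Rightarrow> nat set list \<Rightarrow> nat set"
  where "query e ys = (case ys of [] \<Rightarrow> cpair C (cfalse C) e | y # _ \<Rightarrow> ret y [])"

text \<open>The two alternatives of the union exclude each other when \<open>Q\<close> follows the protocol.\<close>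

definition seq :: "(nat set list \<Rightarrow> nat set) \<Rightarrow> (nat set \<Rightarrow> nat set list \<Rightarrow> nat set) \<Rightarrow>
    nat set list \<Rightarrow> nat set"
  where "seq Q K ys = {y. (\<forall>i\<le>length ys. f_mark \<in> p0 \<bullet>\<bullet> Q (take i ys)) \<and> y \<in> Q ys \<or>
    (\<exists>n. n \<le> length ys \<and> (\<forall>i<n. f_mark \<in> p0 \<bullet>\<bullet> Q (take i ys)) \<and>
      t_mark \<in> p0 \<bullet>\<bullet> Q (take n ys) \<and> y \<in> K (p1 \<bullet>\<bullet> Q (take n ys)) (drop n ys))}"

lemma scott_run: "scott A \<Longrightarrow> scott F \<Longrightarrow> scott_list L \<Longrightarrow> scott (\<lambda>X. run (A X) (F X) (L X))"
  unfolding run_def by (intro scott_gapp scott_cseq scott_list_Cons)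

lemma scott_ret: "scott F \<Longrightarrow> scott (\<lambda>X. ret (F X) (L X))"
  unfolding ret_def by (intro scott_cpair scott_const)

lemma scott_query:
  assumes "scott F" "scott_list L"
  shows "scott (\<lambda>X. query (F X) (L X))"
proof -
  obtain Fs where "\<forall>F\<in>set Fs. scott F" "L = (\<lambda>X. map (\<lambda>F. F X) Fs)"
    using assms(2) unfolding scott_list_def by blast
  with assms(1) show ?thesis
    unfolding query_def by (cases Fs) (auto intro!: scott_cpair scott_const scott_ret)
qed

lemma scott_seq:
  assumes Q: "\<And>L. scott_list L \<Longrightarrow> scott (\<lambda>X. Q X (L X))"
    and K: "\<And>F L. scott F \<Longrightarrow> scott_list L \<Longrightarrow> scott (\<lambda>X. K X (F X) (L X))"
    and L: "scott_list L"
  shows "scott (\<lambda>X. seq (Q X) (K X) (L X))"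
proof -
  \<comment> \<open>With the length independent of \<open>X\<close>, the bounded quantifiers in
    \<open>seq\<close> range over fixed finite sets.\<close>
  obtain n where n: "\<And>X. length (L X) = n"
    using L unfolding scott_list_def by force
  show ?thesis
    unfolding seq_def n
    by (rule scottI, unfold mem_Collect_eq)
      (intro scott_open_intros scott_open_const Q K scott_gapp scott_const scott_list_take
        scott_list_drop L)
qed

section \<open>The algebra with complementation adjoined\<close>

text \<open>The queries \<open>es\<close> are kept as an argument so that the runs of two programs
  can be concatenated.\<close>

definition computes :: "(nat set list \<Rightarrow> nat set) \<Rightarrow> nat set list \<Rightarrow> nat set \<Rightarrow> bool"
  where "computes Q es c \<longleftrightarrow>
    (\<forall>i<length es. Q (map uminus (take i es)) = cpair C (cfalse C) (es ! i)) \<and>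
    Q (map uminus es) = cpair C (ctrue C) c"

lemma oracle_computes_iff:
  "oracle_computes graph_app C (\<lambda>A. Some (UNIV - A)) a b c \<longleftrightarrow> (\<exists>es. computes (run a b) es c)"
proof -
  have "(\<lambda>e::nat set. the (Some (UNIV - e))) = uminus" by auto
  then show ?thesis
    by (simp add: oracle_computes_def computes_def run_def graph_app_eq dom_def)
qed

lemma cpair_inject: "cpair C A B = cpair C A' B' \<longleftrightarrow> A = A' \<and> B = B'"
  by (metis p0 p1)

lemma true_neq_false: "ctrue C \<noteq> cfalse C"
  using not_true_le_false by blast

text \<open>Runs are deterministic: equal queries so far give equal answers, and these determine the
  next query.\<close>

lemma computes_prefix:
  assumes Q: "computes Q es c" "computes Q es' c'" and i: "i \<le> length es" "i \<le> length es'"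
  shows "take i es = take i es'"
  using i
proof (induction i)
  case (Suc i)
  then have "take i es = take i es'" by simp
  moreover from this have "es ! i = es' ! i"
    using Q Suc.prems unfolding computes_def by (metis Suc_le_eq cpair_inject)
  ultimately show ?case
    using Suc.prems by (simp add: take_Suc_conv_app_nth)
qed simp

text \<open>Otherwise \<open>es\<close> is a proper prefix of \<open>es'\<close>, and after the
  answers to \<open>es\<close> the step function would both halt and ask.\<close>

lemma computes_length_le:
  assumes "computes Q es c" "computes Q es' c'"
  shows "length es' \<le> length es"
proof (rule ccontr)
  assume *: "\<not> length es' \<le> length es"
  then have "es = take (length es) es'"
    using computes_prefix[OF assms, of "length es"] by simp
  with * assms show False
    unfolding computes_def by (metis cpair_inject true_neq_false not_le)
qed

lemma computes_unique:
  assumes "computes Q es c" "computes Q es' c'"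
  shows "c = c'"
proof -
  have "length es = length es'"
    using computes_length_le[OF assms] computes_length_le[OF assms(2,1)] by simp
  then have "es = es'"
    using computes_prefix[OF assms, of "length es"] by simp
  with assms show ?thesis by (simp add: computes_def cpair_inject)
qed

section \<open>Runs of the building blocks\<close>

lemma computes_ret: "computes (ret c) [] c"
  by (simp add: computes_def ret_def)

lemma computes_query: "computes (query e) [e] (- e)"
  by (simp add: computes_def query_def ret_def)

text \<open>With fewer than \<open>length es\<close> answers, \<open>seq Q K\<close> copies
  \<open>Q\<close>. From then on the first \<open>length es\<close> answers reproduce the result
  \<open>u\<close>, and \<open>K u\<close> sees only the remaining ones.\<close>

lemma computes_seq:
  assumes Q: "computes Q es u" and K: "computes (K u) es' v"
  shows "computes (seq Q K) (es @ es') v"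
proof -
  have ask: "p0 \<bullet>\<bullet> Q (map uminus (take i es)) = cfalse C" if "i < length es" for i
    using Q that by (simp add: computes_def p0)
  have halt: "p0 \<bullet>\<bullet> Q (map uminus es) = ctrue C" "p1 \<bullet>\<bullet> Q (map uminus es) = u"
    using Q by (simp_all add: computes_def p0 p1)
  \<comment> \<open>All verdicts of \<open>Q\<close> up to this point are false, so the first
    alternative of \<open>seq\<close> applies, while the second would need \<open>t_mark\<close> in
    one of them.\<close>
  have before: "seq Q K (map uminus (take i es)) = Q (map uminus (take i es))"
    if "i < length es" for i
  proof -
    have "p0 \<bullet>\<bullet> Q (take j (map uminus (take i es))) = cfalse C" if "j \<le> i" for j
      using ask[of j] that \<open>i < length es\<close> by (simp add: take_map min_def)
    then show ?thesis
      using that by (auto simp: seq_def f_mark t_mark)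
  qed
  have after: "seq Q K (map uminus es @ zs) = K u zs" for zs
  proof -
    let ?ys = "map uminus es @ zs"
    have lt: "p0 \<bullet>\<bullet> Q (take j ?ys) = cfalse C" if "j < length es" for j
      using ask[OF that] that by (simp add: take_map)
    have eq: "p0 \<bullet>\<bullet> Q (take (length es) ?ys) = ctrue C"
      using halt by simp
    \<comment> \<open>An \<open>n\<close> below \<open>length es\<close> fails the test for
      \<open>t_mark\<close>; an \<open>n\<close> above it fails the test for \<open>f_mark\<close>
      at \<open>length es\<close>. So the second alternative can only split the answers
      there.\<close>
    have halts: "n \<le> length ?ys \<and> (\<forall>i<n. f_mark \<in> p0 \<bullet>\<bullet> Q (take i ?ys)) \<and>
        t_mark \<in> p0 \<bullet>\<bullet> Q (take n ?ys) \<and> R \<longleftrightarrow> n = length es \<and> R" for n R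
    proof (cases n "length es" rule: linorder_cases)
      case less
      then show ?thesis using lt t_mark by simp
    next
      case equal
      then show ?thesis using lt eq t_mark f_mark by simp
    next
      case greater
      then show ?thesis using eq f_mark by blast
    qed
    have "(\<forall>i\<le>length ?ys. f_mark \<in> p0 \<bullet>\<bullet> Q (take i ?ys)) \<longleftrightarrow> False"
      using eq f_mark(2) by (intro iffI) (drule spec[of _ "length es"], simp_all)
    then show ?thesis
      by (simp only: seq_def halts) (simp add: halt)
  qed
  have "seq Q K (map uminus (take i (es @ es'))) = cpair C (cfalse C) ((es @ es') ! i)"
    if "i < length (es @ es')" for i
  proof (cases "i < length es")
    case True
    then show ?thesis using before Q by (simp add: computes_def nth_append)
  next
    case False
    then show ?thesis using after K that by (simp add: computes_def nth_append)
  qed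
  moreover have "seq Q K (map uminus (es @ es')) = cpair C (ctrue C) v"
    using after K by (simp add: computes_def)
  ultimately show ?thesis by (simp add: computes_def)
qed

section \<open>Application, combinators and representability\<close>

abbreviation capp :: "nat set \<Rightarrow> nat set \<Rightarrow> nat set option"
  where "capp \<equiv> adjoin graph_app C (\<lambda>A. Some (UNIV - A))"

lemma capp_eq_Some_iff: "capp a b = Some c \<longleftrightarrow> (\<exists>es. computes (run a b) es c)"
proof (cases "\<exists>c es. computes (run a b) es c")
  case True
  then obtain c' es' where c': "computes (run a b) es' c'" by blast
  \<comment> \<open>Uniqueness of the result makes the definite description in \<open>adjoin\<close>
    denote \<open>c'\<close>.\<close>
  have R: "(\<exists>es. computes (run a b) es x) \<longleftrightarrow> x = c'" for x
    using c' computes_unique[OF c'] by blast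
  show ?thesis
    unfolding adjoin_def oracle_computes_iff R by auto
next
  case False
  then show ?thesis
    unfolding adjoin_def oracle_computes_iff by auto
qed

lemma capp_prog:
  assumes "\<And>F L. scott F \<Longrightarrow> scott_list L \<Longrightarrow> scott (\<lambda>X. P (F X) (L X))"
    and "computes (P b) es c"
  shows "capp (prog P) b = Some c"
proof -
  have "run (prog P) b = P b"
    by (rule ext) (simp add: run_def prog_cseq[of P, OF assms(1)])
  then show ?thesis
    using assms(2) by (auto simp: capp_eq_Some_iff)
qed

lemma pca_capp: "pca capp"
proof -
  \<comment> \<open>The result \<open>u\<close> of \<open>a\<close> on \<open>c\<close> is kept
    while \<open>b\<close> runs on \<open>c\<close>; the result of the latter then becomes the input
    of \<open>u\<close>.\<close>
  let ?S = "\<lambda>a b c. seq (run a c) (\<lambda>u. seq (run b c) (run u))"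
  define k' where "k' a = prog (\<lambda>b. ret a)" for a
  define k where "k = prog (\<lambda>a. ret (k' a))"
  define s2 where "s2 a b = prog (?S a b)" for a b
  define s1 where "s1 a = prog (\<lambda>b. ret (s2 a b))" for a
  define s where "s = prog (\<lambda>a. ret (s1 a))"
  have k: "capp k a = Some (k' a)" for a
    unfolding k_def k'_def
    by (rule capp_prog[OF _ computes_ret]) (intro scott_ret scott_prog)
  have k': "capp (k' a) b = Some a" for a b
    unfolding k'_def by (rule capp_prog[OF _ computes_ret]) (intro scott_ret scott_const)
  have s: "capp s a = Some (s1 a)" for a
    unfolding s_def s1_def s2_def
    by (rule capp_prog[OF _ computes_ret])
      (intro scott_ret scott_prog scott_seq scott_run scott_const scott_list_const)
  have s1: "capp (s1 a) b = Some (s2 a b)" for a b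
    unfolding s1_def s2_def
    by (rule capp_prog[OF _ computes_ret])
      (intro scott_ret scott_prog scott_seq scott_run scott_const scott_list_const)
  have s2: "capp (s2 a b) c = Some w"
    if app: "capp a c = Some u" "capp b c = Some v" "capp u v = Some w" for a b c u v w
  proof -
    obtain es es' es'' where
      "computes (run a c) es u" "computes (run b c) es' v" "computes (run u v) es'' w"
      using app unfolding capp_eq_Some_iff by blast
    then have "computes (?S a b c) (es @ es' @ es'') w"
      by (intro computes_seq)
    then show ?thesis
      unfolding s2_def
      by (rule capp_prog[rotated]) (intro scott_seq scott_run scott_const)
  qed
  show ?thesis
    unfolding pca_def
  proof (rule exI[of _ k], rule exI[of _ s], intro allI conjI impI)
    fix a b c
    assume "lift_app capp (lift_app capp (Some a) (Some c)) (lift_app capp (Some b) (Some c)) \<noteq> None"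
    then obtain u v w where "capp a c = Some u" "capp b c = Some v" "capp u v = Some w"
      by (auto simp: lift_app_def split: bind_splits)
    then show "lift_app capp (lift_app capp (lift_app capp (Some s) (Some a)) (Some b)) (Some c) =
        lift_app capp (lift_app capp (Some a) (Some c)) (lift_app capp (Some b) (Some c))"
      by (simp add: lift_app_Some s s1 s2)
  qed (simp_all add: lift_app_Some k k' s s1)
qed

lemma representable_capp:
  assumes f: "continuous_map (subtopology cantor_topology (dom f)) cantor_topology (\<lambda>a. the (f a))"
  shows "representable capp f"
proof -
  \<comment> \<open>\<open>n\<close> is put into \<open>G B B'\<close> when finite positive
    information from \<open>B\<close> and negative information from \<open>B'\<close> force it into
    all values of \<open>f\<close>. For overlapping \<open>p\<close> and \<open>q\<close> this is
    vacuous, but \<open>B' = - B\<close> excludes overlap.\<close>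
  define G where "G B B' = {n. \<exists>p q. finite p \<and> finite q \<and> p \<subseteq> B \<and> q \<subseteq> B' \<and>
    (\<forall>A\<in>dom f \<inter> cantor_basic p q. n \<in> the (f A))}" for B B'
  have scott_G: "scott (\<lambda>X. G (F X) (F' X))" if "scott F" "scott F'" for F F'
  proof (rule scottI)
    fix n
    \<comment> \<open>Inclusion of an infinite set need not be Scott open, so finiteness is settled
      first; where it fails, the condition is constantly false.\<close>
    have "scott_open (\<lambda>X. finite p \<and> finite q \<and> p \<subseteq> F X \<and> q \<subseteq> F' X \<and>
        (\<forall>A\<in>dom f \<inter> cantor_basic p q. n \<in> the (f A)))" for p q
    proof (cases "finite p \<and> finite q")
      case True
      then show ?thesis
        using that by (intro scott_open_conj scott_open_subset scott_open_const) auto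
    next
      case False
      then have "(\<lambda>X. finite p \<and> finite q \<and> p \<subseteq> F X \<and> q \<subseteq> F' X \<and>
          (\<forall>A\<in>dom f \<inter> cantor_basic p q. n \<in> the (f A))) = (\<lambda>X. False)"
        by blast
      then show ?thesis by (simp only: scott_open_const)
    qed
    then show "scott_open (\<lambda>X. n \<in> G (F X) (F' X))"
      unfolding G_def mem_Collect_eq by (intro scott_open_ex)
  qed
  have G: "G B (- B) = the (f B)" if B: "B \<in> dom f" for B
  proof (intro set_eqI iffI)
    fix n assume "n \<in> G B (- B)"
    then show "n \<in> the (f B)"
      using B by (auto simp: G_def cantor_basic_def)
  next
    fix n assume n: "n \<in> the (f B)"
    \<comment> \<open>\<open>cantor_basic {n} {}\<close> consists of all sets containing
      \<open>n\<close>. A basic neighbourhood of \<open>B\<close> inside its preimage supplies the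
      \<open>p\<close> and \<open>q\<close> for \<open>G\<close>.\<close>
    have "openin (subtopology cantor_topology (dom f))
        {A \<in> topspace (subtopology cantor_topology (dom f)). the (f A) \<in> cantor_basic {n} {}}"
      by (rule openin_continuous_map_preimage[OF f]) (simp add: openin_cantor_basic)
    then obtain V where V: "openin cantor_topology V" "{A \<in> dom f. n \<in> the (f A)} = V \<inter> dom f"
      by (auto simp: openin_subtopology topspace_cantor_topology cantor_basic_def)
    with B n have "B \<in> V" by blast
    with V(1) obtain p q where
      "finite p" "finite q" "B \<in> cantor_basic p q" "cantor_basic p q \<subseteq> V"
      unfolding openin_cantor_topology_iff by meson
    with V(2) show "n \<in> G B (- B)"
      unfolding G_def mem_Collect_eq
      by - (rule exI[of _ p], rule exI[of _ q], auto simp: cantor_basic_def)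
  qed
  let ?P = "\<lambda>b. seq (query b) (\<lambda>v. ret (G b v))"
  have "capp (prog ?P) B = f B" if "B \<in> dom f" for B
  proof -
    \<comment> \<open>The only query is \<open>B\<close> itself, answered by \<open>- B\<close>;
      returning the value of \<open>G\<close> asks nothing more.\<close>
    have "computes (?P B) ([B] @ []) (the (f B))"
      unfolding G[OF that, symmetric] by (rule computes_seq[OF computes_query computes_ret])
    then have "capp (prog ?P) B = Some (the (f B))"
      by (rule capp_prog[rotated]) (intro scott_seq scott_query scott_ret scott_G)
    with that show ?thesis by auto
  qed
  then show ?thesis unfolding representable_def by blast
qed

end

lemma standard_coding_graph:
  assumes "standard_coding graph_app C"
  shows "\<exists>d p p0 p1 zero pred len proj snoc.
    graph_coding C d p p0 p1 zero pred len proj snoc"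
  using assms unfolding standard_coding_def lift_app_Some graph_app_eq option.inject
  unfolding graph_coding_def by metis

theorem lemma2p5:
  fixes C :: "nat set coding"
  assumes "standard_coding graph_app C"
  shows "conrep_topology (adjoin graph_app C (\<lambda>A. Some (UNIV - A))) cantor_topology"
proof -
  obtain d p p0 p1 zero pred len proj snoc where
    "graph_coding C d p p0 p1 zero pred len proj snoc"
    using standard_coding_graph[OF assms] by blast
  then interpret graph_coding C d p p0 p1 zero pred len proj snoc .
  show ?thesis
    unfolding conrep_topology_def
    using pca_capp representable_capp topspace_cantor_topology by blast
qed

end
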